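(* Let $a,b$ be non-negative integers and let $p$ be a prime number such that $\max(a,b)+3\leq p$. Let $S_{a,b,1}=\sum_{i=1}^{p-1} i^b H_i^{(a)}$. Then the following congruences hold. 1. If $0<a\leq b$, then $$S_{a,b,1}\equiv \frac{1}{b+1}\binom{b+1}{a}B_{b-a+1}-\frac{p}{b+1}\sum_{j=0}^{b-a+1}\binom{b+1}{j}B_{b-a+1-j}B_j-\frac{p}{b+1}\sum_{j=b-a+2}^{b}\binom{b+1}{j}B^\#_{a,b,j,p}\pmod{p^2},$$ where the last sum is present only when $a\geq 2$ (it is empty for $a=1$). 2. If $0<a=b+1$, then $$S_{a,b,1}\equiv \frac{1-p}{a}-\frac pa\sum_{j=1}^{a-1}\binom{a}{j}B^\#_{a,a-1,j,p}\pmod{p^2}.$$ 3. If $0<b+1<a$, then $$S_{a,b,1}\equiv -\frac{p}{b+1}\sum_{j=0}^{b}\binom{b+1}{j}B^\#_{a,b,j,p}\pmod{p^2}.$$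
   Context: For an integer $r$ and a positive integer $n$, $H_n^{(r)}=\sum_{k=1}^n k^{-r}$ is the generalized harmonic number. $B_n$ denotes the $n$-th Bernoulli number, with the convention $B_0=1$, $B_1=-\tfrac12$. For integers $a,b,j$ and a prime $p$, $$B^\#_{a,b,j,p}=\frac{a-b-1+j}{a-b+j}\,B_{p-a+b-j}\,B_j .$$ Congruences are between rational numbers whose denominators are not divisible by $p$: $\frac mn\equiv\frac rs \pmod{p^k}$ means $ms\equiv nr\pmod{p^k}$, where $n,s$ are not divisible by $p$. Empty sums equal $0$. *)

theory Defs
  imports "HOL-Number_Theory.Number_Theory"
begin

definition gen_harm :: "int \<Rightarrow> nat \<Rightarrow> rat" where
  "gen_harm r n = (\<Sum>k=1..n. (of_nat k :: rat) powi (- r))"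

(* The usual recursion (\<Sum>k\<le>n. (n+1 choose k) * B_k) = 0 for n > 0, with B_0 = 1;
   it yields the convention B_1 = -1/2. *)
fun bernoulli :: "nat \<Rightarrow> rat" where
  "bernoulli 0 = 1"
| "bernoulli (Suc n) =
     - (\<Sum>k\<le>n. of_nat (Suc (Suc n) choose k) * bernoulli k) / of_nat (Suc (Suc n))"

declare bernoulli.simps(2) [simp del]

lemma bernoulli_1: "bernoulli 1 = - 1 / 2"
  by (simp add: bernoulli.simps(2))

(* Only meaningful when a - b + j is nonzero and both Bernoulli indices are nonnegative. *)
definition bern_sharp :: "int \<Rightarrow> int \<Rightarrow> int \<Rightarrow> nat \<Rightarrow> rat" where
  "bern_sharp a b j p =
     of_int (a - b - 1 + j) / of_int (a - b + j)
       * bernoulli (nat (int p - a + b - j)) * bernoulli (nat j)"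

(* S_{a,b,1}, with the dependence on p made explicit *)
definition harm_sum :: "nat \<Rightarrow> nat \<Rightarrow> nat \<Rightarrow> rat" where
  "harm_sum a b p = (\<Sum>i=1..p-1. of_nat i ^ b * gen_harm (int a) i)"

(* In particular, both rationals are required to be p-integral. *)
definition rat_cong :: "nat \<Rightarrow> nat \<Rightarrow> rat \<Rightarrow> rat \<Rightarrow> bool" where
  "rat_cong p k x y \<longleftrightarrow>
     (\<exists>m n r s :: int. \<not> int p dvd n \<and> \<not> int p dvd s \<and>
        x = of_int m / of_int n \<and> y = of_int r / of_int s \<and>
        [m * s = n * r] (mod (int p ^ k)))"

end

theory Submission
  imports Defs
begin

text \<open>
Summing by parts and writing $P(n) = \sum_{i<n} i^b$,
\[ S_{a,b,1} = \sum_{k=1}^{p-1} k^{-a} \sum_{i=k}^{p-1} i^b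
   = P(p) H_{p-1}^{(a)} - \sum_{k=1}^{p-1} k^{-a} P(k). \]
Faulhaber's formula expands $P(k)$ in powers of $k$ with Bernoulli coefficients, so the second term
becomes a combination of the power sums $\sum_{k<p} k^m$ with $m = b+1-a-j$ for $0 \le j \le b$
(\<open>harm_sum_eq\<close>). The first term is a product of two factors divisible by $p$, hence
vanishes modulo $p^2$ (\<open>harm_sum_cong\<close>). What remains is to know the power sums modulo $p^2$, and the
three sign patterns of $m$ explain the three kinds of terms in the theorem:

\<^item> for $m > 0$ Faulhaber's formula gives $p B_m$, because its other terms carry $p^2$
  (\<open>power_sum_mod_p2\<close>); these are the terms $B_{b-a+1-j} B_j$;

\<^item> for $m = 0$ the sum is $p - 1$, the source of the only term without a factor $p$;

\<^item> for $m = -r < 0$ it is $\frac{r}{r+1}\, p B_{p-1-r}$ (\<open>harmonic_mod_p2\<close>); these are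
  the terms $B^\#$.

The last case is a Kummer congruence. Modulo $p^2$, $k^{-r}$ may be replaced by $k^M$ with
$M = p(p-1) - r$, and $M$ is congruent to $n = p-1-r$ modulo $p-1$. Kummer's congruence is proved for
power sums $S_m = \sum_{k<p} k^m$ directly, in the form $n S_m \equiv m S_n$ modulo $p^2$ (\<open>power_sum_kummer\<close>),
which avoids Bernoulli numbers of large index and their denominators. It comes from Voronoi's idea
(\<open>voronoi\<close>): multiplication by $g$ permutes the nonzero residues, and raising
$gk \bmod p = gk - p \lfloor gk/p \rfloor$ to the power $m$ yields
\[ (g^m - 1) S_m \equiv p m \sum_{k<p} (gk)^{m-1} \lfloor gk/p \rfloor \pmod{p^2}. \]
The sum on the right only matters modulo $p$ and there depends only on $m$ modulo $p-1$; the factor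
$g^m - 1$ is a unit when $g$ is a primitive root.
\<close>

section \<open>Faulhaber's formula\<close>

lemma bernoulli_sum:
  "(\<Sum>j\<le>n. of_nat (Suc n choose j) * bernoulli j) = (if n = 0 then 1 else 0)"
proof (cases n)
  case (Suc m)
  have "of_nat (Suc (Suc m)) * bernoulli (Suc m) =
          - (\<Sum>k\<le>m. of_nat (Suc (Suc m) choose k) * bernoulli k)"
    unfolding bernoulli.simps(2)[of m] by (simp del: of_nat_Suc binomial_Suc_Suc)
  moreover have "Suc (Suc m) choose Suc m = Suc (Suc m)"
    using binomial_symmetric[of 1 "Suc (Suc m)"] by simp
  ultimately show ?thesis
    unfolding Suc by (simp del: of_nat_Suc binomial_Suc_Suc)
qed auto

text \<open>The increment of Faulhaber's polynomial. Expanding $(n+1)^{b+1-j}$ and exchanging the two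
sums, the coefficient of $n^i$ is $\binom{b+1}{i} \sum_{j \le b-i} \binom{b+1-i}{j} B_j$, which the
recursion for the Bernoulli numbers annihilates except for $i = b$.\<close>

lemma faulhaber_step:
  "(\<Sum>j\<le>b. of_nat (Suc b choose j) * bernoulli j *
      ((of_nat n + 1) ^ (Suc b - j) - of_nat n ^ (Suc b - j))) = of_nat (Suc b) * of_nat n ^ b"
proof -
  define x :: rat where "x = of_nat n"
  have diff: "(x + 1) ^ (Suc b - j) - x ^ (Suc b - j) =
      (\<Sum>i | i \<in> {..b} \<and> i + j \<le> b. of_nat (Suc b - j choose i) * x ^ i)" if "j \<le> b" for j
  proof -
    have eq: "{i. i \<in> {..b} \<and> i + j \<le> b} = {..b - j}" using that by auto
    have "Suc b - j = Suc (b - j)" using that by simp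
    then show ?thesis
      unfolding eq by (simp add: binomial_ring[of x 1] del: binomial_Suc_Suc power_Suc)
  qed
  \<comment> \<open>Both sides are the trinomial coefficient that selects disjoint sets of sizes
    \<open>i\<close> and \<open>j\<close>.\<close>
  have choose: "(Suc b choose j) * (Suc b - j choose i) = (Suc b choose i) * (Suc (b - i) choose j)"
    if "i + j \<le> b" for i j
  proof -
    have "(Suc b choose (i + j)) * (i + j choose j) = (Suc b choose j) * (Suc b - j choose i)"
      using choose_mult[of j "i + j" "Suc b"] that by (simp del: binomial_Suc_Suc)
    moreover have "(Suc b choose (i + j)) * (i + j choose i) = (Suc b choose i) * (Suc b - i choose j)"
      using choose_mult[of i "i + j" "Suc b"] that by (simp del: binomial_Suc_Suc)
    moreover have "i + j choose i = i + j choose j"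
      using binomial_symmetric[of i "i + j"] by simp
    ultimately show ?thesis using that by (simp add: Suc_diff_le del: binomial_Suc_Suc)
  qed
  have "(\<Sum>j\<le>b. of_nat (Suc b choose j) * bernoulli j * ((x + 1) ^ (Suc b - j) - x ^ (Suc b - j)))
     = (\<Sum>j\<le>b. \<Sum>i | i \<in> {..b} \<and> i + j \<le> b.
          of_nat (Suc b choose j) * bernoulli j * (of_nat (Suc b - j choose i) * x ^ i))"
    by (intro sum.cong refl) (simp add: diff sum_distrib_left del: binomial_Suc_Suc)
  also have "\<dots> = (\<Sum>i\<le>b. \<Sum>j | j \<in> {..b} \<and> i + j \<le> b.
          of_nat (Suc b choose j) * bernoulli j * (of_nat (Suc b - j choose i) * x ^ i))"
    by (rule sum.swap_restrict) auto
  also have "\<dots> = (\<Sum>i\<le>b. of_nat (Suc b choose i) * x ^ i *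
          (\<Sum>j\<le>b - i. of_nat (Suc (b - i) choose j) * bernoulli j))"
  proof (intro sum.cong refl)
    fix i assume "i \<in> {..b}"
    then have eq: "{j. j \<in> {..b} \<and> i + j \<le> b} = {..b - i}" by auto
    have "of_nat (Suc b choose j) * bernoulli j * (of_nat (Suc b - j choose i) * x ^ i)
        = of_nat (Suc b choose i) * x ^ i * (of_nat (Suc (b - i) choose j) * bernoulli j)"
      if "j \<in> {..b - i}" for j
    proof -
      have "i + j \<le> b" using that \<open>i \<in> {..b}\<close> by auto
      from arg_cong[OF choose[OF this], of "of_nat :: nat \<Rightarrow> rat"]
      have "(of_nat (Suc b choose j) * of_nat (Suc b - j choose i) :: rat)
          = of_nat (Suc b choose i) * of_nat (Suc (b - i) choose j)"
        unfolding of_nat_mult .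
      then have "(of_nat (Suc b choose j) * of_nat (Suc b - j choose i)) * (bernoulli j * x ^ i)
          = (of_nat (Suc b choose i) * of_nat (Suc (b - i) choose j)) * (bernoulli j * x ^ i)"
        by (rule arg_cong)
      then show ?thesis by (simp only: mult_ac)
    qed
    then show "(\<Sum>j | j \<in> {..b} \<and> i + j \<le> b.
          of_nat (Suc b choose j) * bernoulli j * (of_nat (Suc b - j choose i) * x ^ i))
       = of_nat (Suc b choose i) * x ^ i *
          (\<Sum>j\<le>b - i. of_nat (Suc (b - i) choose j) * bernoulli j)"
      unfolding eq sum_distrib_left by (intro sum.cong refl)
  qed
  also have "\<dots> = (\<Sum>i\<le>b. if i = b then of_nat (Suc b) * x ^ b else 0)"
  proof (intro sum.cong refl)
    fix i assume "i \<in> {..b}"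
    moreover have "Suc b choose b = Suc b"
      using binomial_symmetric[of 1 "Suc b"] by simp
    ultimately show "of_nat (Suc b choose i) * x ^ i *
          (\<Sum>j\<le>b - i. of_nat (Suc (b - i) choose j) * bernoulli j)
        = (if i = b then of_nat (Suc b) * x ^ b else 0)"
      unfolding bernoulli_sum by (simp del: binomial_Suc_Suc)
  qed
  finally show ?thesis by (simp add: x_def)
qed

lemma faulhaber:
  "(\<Sum>i<n. of_nat i ^ b) =
     1 / of_nat (Suc b) * (\<Sum>j\<le>b. of_nat (Suc b choose j) * bernoulli j * of_nat n ^ (Suc b - j))"
proof (induction n)
  case 0
  then show ?case by (auto intro!: sum.neutral)
next
  case (Suc n)
  have "(\<Sum>i<Suc n. (of_nat i :: rat) ^ b) = (\<Sum>i<n. of_nat i ^ b) + of_nat n ^ b"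
    by simp
  also have "of_nat n ^ b = 1 / of_nat (Suc b) * (\<Sum>j\<le>b. of_nat (Suc b choose j) * bernoulli j *
      ((of_nat n + 1) ^ (Suc b - j) - of_nat n ^ (Suc b - j)))"
    unfolding faulhaber_step by simp
  finally show ?case
    unfolding Suc.IH by (simp add: algebra_simps sum_subtractf del: binomial_Suc_Suc power_Suc)
qed

section \<open>Kummer's congruence for power sums\<close>

lemma power_diff_cong:
  fixes x y :: int
  shows "[(x - y) ^ Suc m = x ^ Suc m - of_nat (Suc m) * x ^ m * y] (mod y\<^sup>2)"
proof (induction m)
  case (Suc m)
  have "[(x - y) ^ Suc m * (x - y) = (x ^ Suc m - of_nat (Suc m) * x ^ m * y) * (x - y)] (mod y\<^sup>2)"
    using Suc.IH by (rule cong_mult) simp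
  also have "(x ^ Suc m - of_nat (Suc m) * x ^ m * y) * (x - y) =
      x ^ Suc (Suc m) - of_nat (Suc (Suc m)) * x ^ Suc m * y + y\<^sup>2 * (of_nat (Suc m) * x ^ m)"
    by (simp add: algebra_simps power2_eq_square)
  also have "[\<dots> = x ^ Suc (Suc m) - of_nat (Suc (Suc m)) * x ^ Suc m * y] (mod y\<^sup>2)"
    by (simp add: cong_iff_dvd_diff)
  finally show ?case by (simp only: power_Suc2)
qed auto

lemma mult_mod_permutes_residues:
  assumes p: "prime p" and g: "coprime g p"
  shows "bij_betw (\<lambda>k. g * k mod p) {1..p - 1} {1..p - 1 :: nat}"
proof -
  have "inj_on (\<lambda>k. g * k mod p) {1..p - 1}"
  proof (rule inj_onI)
    fix k l assume kl: "k \<in> {1..p - 1}" "l \<in> {1..p - 1}" and "g * k mod p = g * l mod p"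
    then have "[k = l] (mod p)"
      using cong_mult_lcancel_nat[OF g] by (simp add: cong_def)
    then show "k = l"
      using kl by (auto simp: cong_def)
  qed
  moreover have "(\<lambda>k. g * k mod p) ` {1..p - 1} \<subseteq> {1..p - 1}"
  proof clarify
    fix k assume k: "k \<in> {1..p - 1}"
    then have "\<not> p dvd k" by (auto dest: dvd_imp_le)
    moreover have "\<not> p dvd g"
      using g p by (metis coprime_absorb_right not_prime_unit)
    ultimately have "g * k mod p \<noteq> 0"
      using p by (simp add: prime_dvd_mult_iff flip: dvd_eq_mod_eq_0)
    moreover have "g * k mod p < p" using p by (simp add: prime_gt_0_nat)
    ultimately show "g * k mod p \<in> {1..p - 1}" by auto
  qed
  ultimately show ?thesis
    by (simp add: bij_betw_def endo_inj_surj)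
qed

text \<open>Voronoi's congruence for power sums: sum the $(m+1)$-st powers of
$gk \bmod p = gk - p \lfloor gk/p \rfloor$ over the nonzero residues $k$, once by permuting them and
once by expanding to first order in $p$.\<close>

lemma voronoi:
  assumes p: "prime p" and g: "coprime g p"
  shows "[(int g ^ Suc m - 1) * (\<Sum>k=1..p-1. int k ^ Suc m) =
     int p * (int (Suc m) * (\<Sum>k=1..p-1. int (g * k) ^ m * int (g * k div p)))] (mod (int p)\<^sup>2)"
proof -
  have "(\<Sum>k=1..p-1. int k ^ Suc m) = (\<Sum>k=1..p-1. int (g * k mod p) ^ Suc m)"
    by (rule sum.reindex_bij_betw[OF mult_mod_permutes_residues[OF p g], symmetric])
  also have "[\<dots> = (\<Sum>k=1..p-1. int (g * k) ^ Suc m -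
      of_nat (Suc m) * int (g * k) ^ m * (int p * int (g * k div p)))] (mod (int p)\<^sup>2)"
  proof (rule cong_sum)
    fix k
    have "int (g * k mod p) = int (g * k) - int p * int (g * k div p)"
      by (metis minus_mult_div_eq_mod of_nat_mult zmod_int zdiv_int)
    then show "[int (g * k mod p) ^ Suc m = int (g * k) ^ Suc m -
      of_nat (Suc m) * int (g * k) ^ m * (int p * int (g * k div p))] (mod (int p)\<^sup>2)"
      using power_diff_cong[of "int (g * k)" "int p * int (g * k div p)" m]
      by (metis cong_dvd_modulus dvd_triv_left power_mult_distrib)
  qed
  also have "(\<Sum>k=1..p-1. int (g * k) ^ Suc m -
      of_nat (Suc m) * int (g * k) ^ m * (int p * int (g * k div p))) =
      int g ^ Suc m * (\<Sum>k=1..p-1. int k ^ Suc m) -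
      int p * (int (Suc m) * (\<Sum>k=1..p-1. int (g * k) ^ m * int (g * k div p)))"
    by (simp only: sum_subtractf sum_distrib_left of_nat_mult power_mult_distrib mult_ac)
  finally show ?thesis
    by (simp add: cong_iff_dvd_diff algebra_simps dvd_diff_commute del: power_Suc)
qed

lemma ex_primitive_root:
  fixes p :: nat
  assumes p: "prime p"
  obtains g :: nat where "coprime g p" "\<And>n. [g ^ n = 1] (mod p) \<longleftrightarrow> (p - 1) dvd n"
proof -
  obtain g where "residue_primroot p g"
    using prime_primitive_root_exists[OF prime_gt_1_nat[OF p] p] by blast
  then have g: "coprime p g" "ord p g = p - 1"
    by (auto simp: residue_primroot_def totient_prime p)
  then have "coprime g p" by (simp add: coprime_commute)
  then show thesis by (rule that) (simp only: ord_divides g(2))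
qed

lemma power_cong_of_exponent_cong:
  fixes p x :: nat
  assumes p: "prime p" and x: "\<not> p dvd x" and mn: "[m = n] (mod (p - 1))"
  shows "[x ^ m = x ^ n] (mod p)"
proof -
  have cop: "coprime p x" using p x by (simp add: prime_imp_coprime)
  have "ord p x dvd p - 1"
    using order_divides_totient[OF cop] by (simp add: totient_prime p)
  then show ?thesis
    using mn by (simp add: order_divides_expdiff[OF cop] cong_dvd_modulus_nat)
qed

text \<open>Modulo $p$ the right-hand side of Voronoi's congruence vanishes, while $g^n - 1$ is a unit for a
primitive root $g$.\<close>

lemma power_sum_dvd:
  assumes p: "prime p" and n: "\<not> (p - 1) dvd n"
  shows "int p dvd (\<Sum>k=1..p-1. int k ^ n)"
proof -
  obtain g where g: "coprime g p" "\<And>n. [g ^ n = 1] (mod p) \<longleftrightarrow> (p - 1) dvd n"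
    using ex_primitive_root[OF p] by blast
  have "\<not> [int (g ^ n) = int 1] (mod int p)"
    unfolding cong_int_iff using g(2) n by blast
  then have unit: "\<not> int p dvd int g ^ n - 1"
    by (simp add: cong_iff_dvd_diff)
  obtain k where k: "n = Suc k" using n by (cases n) auto
  have "[(int g ^ n - 1) * (\<Sum>k=1..p-1. int k ^ n) = 0] (mod (int p))"
    using cong_dvd_modulus[OF voronoi[OF p g(1), of k], of "int p"] unfolding k
    by (simp add: cong_0_iff cong_dvd_iff del: power_Suc)
  then show ?thesis
    using unit p by (simp add: cong_0_iff prime_dvd_mult_iff)
qed

text \<open>Kummer's congruence $B_m/m \equiv B_n/n$, stated for power sums instead of Bernoulli numbers.
In Voronoi's congruence for $m$ and for $n$ the sums on the right agree modulo $p$, and both carry a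
factor $p$; cross-multiplying by $n$ and $m$ eliminates them. The factors $g^m - 1$ and $g^n - 1$ agree
only modulo $p$, but they multiply power sums that are themselves divisible by $p$.\<close>

lemma power_sum_kummer:
  assumes p: "prime p" and mn: "[m = n] (mod (p - 1))" "0 < m" and n: "\<not> (p - 1) dvd n"
  shows "[int n * (\<Sum>k=1..p-1. int k ^ m) = int m * (\<Sum>k=1..p-1. int k ^ n)] (mod (int p)\<^sup>2)"
proof -
  obtain g where g: "coprime g p" "\<And>n. [g ^ n = 1] (mod p) \<longleftrightarrow> (p - 1) dvd n"
    using ex_primitive_root[OF p] by blast
  have not_dvd_g: "\<not> p dvd g"
    using g(1) p by (metis coprime_absorb_right not_prime_unit)
  obtain m' n' where Suc: "m = Suc m'" "n = Suc n'"
    using mn(2) n by (cases m; cases n) auto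
  have mn': "[m' = n'] (mod (p - 1))"
    using mn(1) cong_add_rcancel_nat[of m' 1 n'] unfolding Suc by simp
  define S where "S = (\<lambda>n. \<Sum>k=1..p-1. int k ^ n)"
  define V where "V = (\<lambda>n. \<Sum>k=1..p-1. int (g * k) ^ n * int (g * k div p))"
  have "[V m' = V n'] (mod int p)"
    unfolding V_def
  proof (intro cong_sum cong_mult cong_refl)
    fix k assume "k \<in> {1..p - 1}"
    then have "\<not> p dvd k" by (auto dest: dvd_imp_le)
    then have "\<not> p dvd g * k" using not_dvd_g p by (simp add: prime_dvd_mult_iff)
    from power_cong_of_exponent_cong[OF p this mn']
    show "[int (g * k) ^ m' = int (g * k) ^ n'] (mod int p)"
      by (metis cong_int_iff of_nat_power)
  qed
  then obtain v where v: "V m' - V n' = int p * v"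
    by (auto simp: cong_iff_dvd_diff)
  obtain s where s: "S n = int p * s"
    using power_sum_dvd[OF p n] unfolding S_def by blast
  have "\<not> (p - 1) dvd m"
    using mn(1) n by (simp add: cong_dvd_iff cong_sym)
  then obtain s' where s': "S m = int p * s'"
    using power_sum_dvd[OF p] unfolding S_def by blast
  have "[int g ^ m = int g ^ n] (mod int p)"
    using power_cong_of_exponent_cong[OF p not_dvd_g mn(1)] by (metis cong_int_iff of_nat_power)
  then obtain t where t: "int g ^ m - int g ^ n = int p * t"
    by (auto simp: cong_iff_dvd_diff)
  obtain u where u: "(int g ^ m - 1) * S m - int p * (int m * V m') = (int p)\<^sup>2 * u"
    using voronoi[OF p g(1), of m'] unfolding Suc S_def V_def by (auto simp: cong_iff_dvd_diff)
  obtain w where w: "(int g ^ n - 1) * S n - int p * (int n * V n') = (int p)\<^sup>2 * w"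
    using voronoi[OF p g(1), of n'] unfolding Suc S_def V_def by (auto simp: cong_iff_dvd_diff)
  have "(int g ^ n - 1) * (int n * S m - int m * S n) =
      int n * ((int g ^ m - 1) * S m - int p * (int m * V m'))
      - int m * ((int g ^ n - 1) * S n - int p * (int n * V n'))
      + int p * int m * int n * (V m' - V n') - int n * (int g ^ m - int g ^ n) * S m"
    by (simp add: algebra_simps)
  also have "\<dots> = (int p)\<^sup>2 * (int n * u - int m * w + int m * int n * v - int n * t * s')"
    by (simp only: u w v t) (simp add: s' algebra_simps power2_eq_square)
  finally have "(int g ^ n - 1) * (int n * S m - int m * S n) =
      (int p)\<^sup>2 * (int n * u - int m * w + int m * int n * v - int n * t * s')" .
  then have "(int p)\<^sup>2 dvd (int g ^ n - 1) * (int n * S m - int m * S n)"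
    by simp
  moreover have "coprime ((int p)\<^sup>2) (int g ^ n - 1)"
  proof -
    have "\<not> [int (g ^ n) = int 1] (mod int p)"
      unfolding cong_int_iff using g(2) n by blast
    then have "\<not> int p dvd int g ^ n - 1"
      by (simp add: cong_iff_dvd_diff)
    then show ?thesis using p by (simp add: prime_imp_coprime)
  qed
  ultimately have "(int p)\<^sup>2 dvd int n * S m - int m * S n"
    by (simp add: coprime_dvd_mult_right_iff)
  then show ?thesis
    by (simp add: S_def cong_iff_dvd_diff)
qed

section \<open>Congruences between $p$-integral rationals\<close>

text \<open>The localisation of the integers at $p$, as a subring of the rationals; congruences modulo
$p^k$ are congruences modulo the ideal that $p^k$ generates in it (\<open>rat_cong_iff\<close>).\<close>

definition p_integral :: "nat \<Rightarrow> rat set" where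
  "p_integral p = {of_int m / of_int n | m n. \<not> int p dvd n}"

lemma p_integral_of_int [simp]: "prime p \<Longrightarrow> of_int m \<in> p_integral p"
  unfolding p_integral_def by (intro CollectI exI[of _ m] exI[of _ 1]) (auto dest: not_prime_unit)

context
  fixes p :: nat
  assumes p: "prime p"
begin

lemma p_integral_frac:
  assumes "\<not> int p dvd n"
  shows "of_int m / of_int n \<in> p_integral p"
  using assms unfolding p_integral_def by blast

lemma p_integral_inverse:
  assumes "0 < n" and "n < p"
  shows "1 / of_nat n \<in> p_integral p"
proof -
  have "\<not> int p dvd int n"
    using assms by (simp add: nat_dvd_not_less)
  from p_integral_frac[OF this, of 1] show ?thesis by simp
qed

lemma p_integral_of_nat [simp]: "of_nat m \<in> p_integral p"
  using p_integral_of_int[OF p, of "int m"] by simp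

lemma p_integral_one [simp]: "1 \<in> p_integral p"
  using p_integral_of_nat[of 1] by simp

lemma p_integral_zero [simp]: "0 \<in> p_integral p"
  using p_integral_of_nat[of 0] by simp

lemma p_integral_add [simp]:
  assumes "x \<in> p_integral p" "y \<in> p_integral p"
  shows "x + y \<in> p_integral p"
proof -
  obtain m n r s where x: "x = of_int m / of_int n" "\<not> int p dvd n"
    and y: "y = of_int r / of_int s" "\<not> int p dvd s"
    using assms unfolding p_integral_def by blast
  have ns: "\<not> int p dvd n * s" using x y p by (simp add: prime_dvd_mult_iff)
  have "n \<noteq> 0" "s \<noteq> 0" using x y by auto
  then have "x + y = of_int (m * s + r * n) / of_int (n * s)"
    unfolding x y by (simp add: add_frac_eq)
  then show ?thesis using p_integral_frac[OF ns] by metis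
qed

lemma p_integral_mult [simp]:
  assumes "x \<in> p_integral p" "y \<in> p_integral p"
  shows "x * y \<in> p_integral p"
proof -
  obtain m n r s where x: "x = of_int m / of_int n" "\<not> int p dvd n"
    and y: "y = of_int r / of_int s" "\<not> int p dvd s"
    using assms unfolding p_integral_def by blast
  have ns: "\<not> int p dvd n * s" using x y p by (simp add: prime_dvd_mult_iff)
  have "x * y = of_int (m * r) / of_int (n * s)"
    unfolding x y by simp
  then show ?thesis using p_integral_frac[OF ns] by metis
qed

lemma p_integral_uminus [simp]: "x \<in> p_integral p \<Longrightarrow> - x \<in> p_integral p"
  using p_integral_mult[OF p_integral_of_int[OF p, of "-1"], of x] by simp

lemma p_integral_diff [simp]:
  "x \<in> p_integral p \<Longrightarrow> y \<in> p_integral p \<Longrightarrow> x - y \<in> p_integral p"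
  using p_integral_add[of x "- y"] by simp

lemma p_integral_power [simp]: "x \<in> p_integral p \<Longrightarrow> x ^ n \<in> p_integral p"
  by (induction n) auto

lemma p_integral_sum [intro]:
  "(\<And>i. i \<in> A \<Longrightarrow> f i \<in> p_integral p) \<Longrightarrow> sum f A \<in> p_integral p"
  by (induction A rule: infinite_finite_induct) auto

lemma rat_cong_iff:
  "rat_cong p k x y \<longleftrightarrow>
     x \<in> p_integral p \<and> (\<exists>z \<in> p_integral p. x - y = of_nat p ^ k * z)"
proof
  assume "rat_cong p k x y"
  then obtain m n r s where x: "x = of_int m / of_int n" "\<not> int p dvd n"
    and y: "y = of_int r / of_int s" "\<not> int p dvd s"
    and c: "[m * s = n * r] (mod (int p ^ k))"
    unfolding rat_cong_def by blast
  obtain t where t: "m * s - n * r = int p ^ k * t"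
    using c by (auto simp: cong_iff_dvd_diff)
  have ns: "\<not> int p dvd n * s" using x y p by (simp add: prime_dvd_mult_iff)
  have "n \<noteq> 0" "s \<noteq> 0" using x y by auto
  then have "x - y = of_int (m * s - n * r) / of_int (n * s)"
    unfolding x y by (simp add: diff_frac_eq mult.commute)
  also have "\<dots> = of_nat p ^ k * (of_int t / of_int (n * s))"
    unfolding t by simp
  finally show "x \<in> p_integral p \<and> (\<exists>z \<in> p_integral p. x - y = of_nat p ^ k * z)"
    using x p_integral_frac ns by blast
next
  assume "x \<in> p_integral p \<and> (\<exists>z \<in> p_integral p. x - y = of_nat p ^ k * z)"
  then obtain m n u v where x: "x = of_int m / of_int n" "\<not> int p dvd n"
    and v: "\<not> int p dvd v" and xy: "x - y = of_nat p ^ k * (of_int u / of_int v)"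
    unfolding p_integral_def by blast
  have nv: "\<not> int p dvd n * v" using x v p by (simp add: prime_dvd_mult_iff)
  have "n \<noteq> 0" "v \<noteq> 0" using x v by auto
  moreover have "y = x - of_nat p ^ k * (of_int u / of_int v)"
    using xy by (simp add: algebra_simps)
  ultimately have y: "y = of_int (m * v - int p ^ k * u * n) / of_int (n * v)"
    unfolding x by (simp add: field_simps)
  have "m * (n * v) - n * (m * v - int p ^ k * u * n) = int p ^ k * (u * n * n)"
    by (simp add: algebra_simps)
  then have "[m * (n * v) = n * (m * v - int p ^ k * u * n)] (mod (int p ^ k))"
    by (simp add: cong_iff_dvd_diff)
  then show "rat_cong p k x y"
    unfolding rat_cong_def using x nv y by blast
qed

lemma rat_cong_refl: "x \<in> p_integral p \<Longrightarrow> rat_cong p k x x"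
  by (auto simp: rat_cong_iff intro: bexI[of _ 0])

lemma rat_cong_integral_left: "rat_cong p k x y \<Longrightarrow> x \<in> p_integral p"
  by (simp add: rat_cong_iff)

lemma rat_cong_sym:
  assumes "rat_cong p k x y"
  shows "rat_cong p k y x"
proof -
  obtain z where z: "z \<in> p_integral p" "x - y = of_nat p ^ k * z" and x: "x \<in> p_integral p"
    using assms by (auto simp: rat_cong_iff)
  have yx: "y - x = of_nat p ^ k * (- z)" "y = x - of_nat p ^ k * z"
    using z by (auto simp: algebra_simps)
  have "y \<in> p_integral p"
    unfolding yx(2) using x z by simp
  then show ?thesis using z yx(1) unfolding rat_cong_iff by (blast intro: p_integral_uminus)
qed

lemma rat_cong_trans:
  assumes "rat_cong p k x y" "rat_cong p k y z"
  shows "rat_cong p k x z"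
proof -
  obtain u v where "u \<in> p_integral p" "x - y = of_nat p ^ k * u"
      "v \<in> p_integral p" "y - z = of_nat p ^ k * v" and x: "x \<in> p_integral p"
    using assms by (auto simp: rat_cong_iff)
  moreover from this have "x - z = of_nat p ^ k * (u + v)"
    by (simp add: algebra_simps)
  ultimately show ?thesis unfolding rat_cong_iff by (blast intro: p_integral_add)
qed

lemma rat_cong_add:
  assumes "rat_cong p k x y" "rat_cong p k x' y'"
  shows "rat_cong p k (x + x') (y + y')"
proof -
  obtain u v where "u \<in> p_integral p" "x - y = of_nat p ^ k * u"
      "v \<in> p_integral p" "x' - y' = of_nat p ^ k * v"
      "x \<in> p_integral p" "x' \<in> p_integral p"
    using assms by (auto simp: rat_cong_iff)
  moreover from this have "(x + x') - (y + y') = of_nat p ^ k * (u + v)"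
    by (simp add: algebra_simps)
  ultimately show ?thesis unfolding rat_cong_iff by (blast intro: p_integral_add)
qed

lemma rat_cong_mult_left:
  assumes "c \<in> p_integral p" "rat_cong p k x y"
  shows "rat_cong p k (c * x) (c * y)"
proof -
  obtain u where "u \<in> p_integral p" "x - y = of_nat p ^ k * u" "x \<in> p_integral p"
    using assms by (auto simp: rat_cong_iff)
  moreover from this have "c * x - c * y = of_nat p ^ k * (c * u)"
    by (simp add: algebra_simps flip: right_diff_distrib)
  ultimately show ?thesis using assms(1) unfolding rat_cong_iff by (blast intro: p_integral_mult)
qed

lemma rat_cong_sum:
  assumes "\<And>i. i \<in> A \<Longrightarrow> rat_cong p k (f i) (g i)"
  shows "rat_cong p k (sum f A) (sum g A)"
  using assms
  by (induction A rule: infinite_finite_induct) (auto intro: rat_cong_add rat_cong_refl)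

lemma rat_cong_of_int:
  assumes "[m = n] (mod int p ^ k)"
  shows "rat_cong p k (of_int m) (of_int n)"
  unfolding rat_cong_def
  using assms p by (intro exI[of _ m] exI[of _ 1] exI[of _ n]) (auto dest: not_prime_unit)

end

section \<open>Power sums with positive and negative exponents modulo $p^2$\<close>

lemma gen_harm_neg: "gen_harm (- int n) N = of_int (\<Sum>k=1..N. int k ^ n)"
  by (simp add: gen_harm_def)

lemma gen_harm_zero: "gen_harm 0 N = of_nat N"
  by (simp add: gen_harm_def)

context
  fixes p :: nat
  assumes p: "prime p"
begin

lemma rat_cong_power_mult_0:
  "z \<in> p_integral p \<Longrightarrow> rat_cong p k (of_nat p ^ k * z) 0"
  using p by (auto simp: rat_cong_iff)

text \<open>The recursion for $B_n$ divides by $n + 1$ only, so $p$ cannot enter a denominator before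
$n = p - 1$.\<close>

lemma bernoulli_p_integral:
  assumes "n + 2 \<le> p"
  shows "bernoulli n \<in> p_integral p"
  using assms
proof (induction n rule: less_induct)
  case (less n)
  show ?case
  proof (cases n)
    case (Suc m)
    have "(\<Sum>k\<le>m. of_nat (Suc (Suc m) choose k) * bernoulli k) \<in> p_integral p"
      using less p Suc by (intro p_integral_sum p_integral_mult) auto
    moreover have "1 / of_nat (Suc (Suc m)) \<in> p_integral p"
      using less.prems Suc p by (intro p_integral_inverse) auto
    ultimately have "- ((1 / of_nat (Suc (Suc m))) *
        (\<Sum>k\<le>m. of_nat (Suc (Suc m) choose k) * bernoulli k)) \<in> p_integral p"
      using p by (intro p_integral_uminus p_integral_mult)
    then show ?thesis
      by (simp add: Suc bernoulli.simps(2) del: of_nat_Suc binomial_Suc_Suc)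
  qed (use p in simp)
qed

text \<open>In Faulhaber's formula at $p$ the coefficients are $p$-integral because $b + 1 < p$, and all
terms but the one with $B_b$ contain $p^2$. With $b = 0$ the summand for $i = 0$ is $0^0 = 1$.\<close>

lemma faulhaber_mod_p2:
  assumes "b + 2 \<le> p"
  shows "rat_cong p 2 (\<Sum>i<p. of_nat i ^ b) (of_nat p * bernoulli b)"
proof -
  let ?f = "\<lambda>j. of_nat (Suc b choose j) * bernoulli j * of_nat p ^ (Suc b - j)"
  have high: "rat_cong p 2 (?f j) 0" if "j < b" for j
  proof -
    have "Suc b - j = 2 + (b - j - 1)" using that by simp
    then have "?f j = of_nat p ^ 2 * (of_nat (Suc b choose j) * bernoulli j * of_nat p ^ (b - j - 1))"
      by (simp only: power_add mult_ac)
    moreover have "bernoulli j \<in> p_integral p"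
      using that assms by (intro bernoulli_p_integral) simp
    ultimately show ?thesis
      using p by (simp only:) (intro rat_cong_power_mult_0 p_integral_mult p_integral_power
          p_integral_of_nat)
  qed
  have inv: "1 / of_nat (Suc b) \<in> p_integral p"
    using p assms by (intro p_integral_inverse) auto
  have b: "bernoulli b \<in> p_integral p"
    using assms by (rule bernoulli_p_integral)
  have "Suc b choose b = Suc b"
    using binomial_symmetric[of 1 "Suc b"] by simp
  then have top: "?f b = of_nat (Suc b) * (of_nat p * bernoulli b)"
    by (simp del: binomial_Suc_Suc)
  have "(\<Sum>i<p. of_nat i ^ b) = 1 / of_nat (Suc b) * (?f b + (\<Sum>j<b. ?f j))"
    unfolding faulhaber by (simp add: lessThan_Suc_atMost[symmetric] del: binomial_Suc_Suc)
  also have "rat_cong p 2 \<dots> (1 / of_nat (Suc b) * (?f b + (\<Sum>j<b. 0)))"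
  proof (rule rat_cong_mult_left[OF p inv], rule rat_cong_add[OF p])
    show "rat_cong p 2 (?f b) (?f b)"
      using p b by (intro rat_cong_refl p_integral_mult p_integral_power p_integral_of_nat)
    show "rat_cong p 2 (\<Sum>j<b. ?f j) (\<Sum>j<b. 0)"
      using high by (intro rat_cong_sum[OF p]) auto
  qed
  also have "1 / of_nat (Suc b) * (?f b + (\<Sum>j<b. 0)) = of_nat p * bernoulli b"
    unfolding top by simp
  finally show ?thesis .
qed

lemma power_sum_mod_p2:
  assumes "0 < n" and "n + 2 \<le> p"
  shows "rat_cong p 2 (gen_harm (- int n) (p - 1)) (of_nat p * bernoulli n)"
proof -
  have "{..<p} = insert 0 {1..p - 1}"
    using p prime_gt_0_nat[of p] by auto
  then have "(\<Sum>i<p. (of_nat i :: rat) ^ n) = gen_harm (- int n) (p - 1)"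
    using assms(1) by (simp add: gen_harm_neg)
  then show ?thesis using faulhaber_mod_p2[OF assms(2)] by simp
qed

text \<open>Euler's theorem modulo $p^2$, whose totient is $p(p-1)$, turns a negative exponent into a
natural one.\<close>

lemma negative_power_mod_p2:
  assumes "\<not> p dvd k" and "r \<le> p * (p - 1)"
  shows "rat_cong p 2 (of_nat k powi (- int r)) (of_nat k ^ (p * (p - 1) - r))"
proof -
  have "coprime k (p\<^sup>2)"
    using prime_imp_coprime[OF p assms(1)] by (simp add: coprime_commute)
  then have "[k ^ totient (p\<^sup>2) = 1] (mod p\<^sup>2)"
    by (rule euler_theorem)
  moreover have "totient (p\<^sup>2) = p * (p - 1)"
    using p by (simp add: totient_prime_power)
  ultimately have "[int (k ^ (p * (p - 1))) = int 1] (mod int (p\<^sup>2))"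
    unfolding cong_int_iff by (simp only:)
  then have "rat_cong p 2 (of_int (int (k ^ (p * (p - 1))))) (of_int (int 1))"
    using p by (intro rat_cong_of_int) auto
  then have one: "rat_cong p 2 1 (of_nat k ^ (p * (p - 1)))"
    using rat_cong_sym[OF p] by simp
  have "\<not> p dvd k ^ r"
    using assms(1) prime_dvd_power[OF p] by blast
  then have "\<not> int p dvd int k ^ r"
    by (simp flip: of_nat_power)
  from p_integral_frac[OF p this, of 1]
  have "1 / of_nat k ^ r \<in> p_integral p" by simp
  from rat_cong_mult_left[OF p this one]
  have "rat_cong p 2 (1 / of_nat k ^ r) (of_nat k ^ (p * (p - 1)) / of_nat k ^ r)"
    by simp
  moreover have "k \<noteq> 0" using assms(1) by (intro notI) simp
  ultimately show ?thesis
    using assms(2) by (simp add: power_int_minus divide_inverse power_diff)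
qed

text \<open>With $M = p(p-1) - r$ and $n = p-1-r$, Kummer's congruence compares $S_M$, which is the harmonic
sum, with $S_n \equiv p B_n$. Both power sums are divisible by $p$, so the factors $n$ and $M$ matter only modulo $p$,
where they are $-(r+1)$ and $-r$. This produces $r/(r+1)$.\<close>

lemma harmonic_mod_p2:
  assumes r: "0 < r" and rp: "r + 2 \<le> p"
  shows "rat_cong p 2 (gen_harm (int r) (p - 1))
    (of_nat p * (of_nat r / of_nat (r + 1) * bernoulli (p - 1 - r)))"
proof -
  define n M where "n = p - 1 - r" and "M = p * (p - 1) - r"
  define S where "S = (\<lambda>n. \<Sum>k=1..p-1. int k ^ n)"
  have "1 * (p - 1) \<le> p * (p - 1)" using rp by (intro mult_right_mono) auto
  with rp have "r < p * (p - 1)" by linarith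
  then have n_M: "n + r = p - 1" "M + r = p * (p - 1)" "0 < n" "0 < M" "n < p - 1"
    using rp r by (auto simp: n_def M_def)
  have "rat_cong p 2 (gen_harm (int r) (p - 1)) (\<Sum>k=1..p-1. of_nat k ^ M)"
    unfolding gen_harm_def M_def
    using \<open>r < p * (p - 1)\<close>
    by (intro rat_cong_sum[OF p] negative_power_mod_p2) (auto dest: dvd_imp_le)
  then have harm: "rat_cong p 2 (gen_harm (int r) (p - 1)) (of_int (S M))"
    by (simp add: S_def)
  have "\<not> (p - 1) dvd n"
    using n_M by (auto dest: dvd_imp_le)
  moreover have "[M = n] (mod (p - 1))"
  proof -
    have "[M + r = n + r] (mod (p - 1))"
      unfolding n_M by (simp add: cong_def)
    then show ?thesis by (simp add: cong_add_rcancel_nat)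
  qed
  ultimately have kummer: "[int n * S M = int M * S n] (mod (int p)\<^sup>2)"
      and "int p dvd S n" "int p dvd S M"
    using power_sum_kummer[OF p] power_sum_dvd[OF p] n_M unfolding S_def
    by (auto simp: cong_dvd_iff)
  obtain s s' where s: "S n = int p * s" "S M = int p * s'"
    using \<open>int p dvd S n\<close> \<open>int p dvd S M\<close> unfolding dvd_def by blast
  obtain w where w: "int n * S M - int M * S n = (int p)\<^sup>2 * w"
    using kummer by (auto simp: cong_iff_dvd_diff)
  have nM': "int n = int p - 1 - int r" "int M = int p * (int p - 1) - int r"
    using n_M rp by (auto simp: of_nat_diff algebra_simps simp flip: of_nat_mult of_nat_add)
  \<comment> \<open>Subtract the multiples of \<open>p\<close> contained in the factors \<open>n\<close> and \<open>M\<close>.\<close>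
  have "int (r + 1) * S M - int r * S n = (int p)\<^sup>2 * (s' - (int p - 1) * s - w)"
    using w s unfolding nM' by (simp add: algebra_simps power2_eq_square)
  then have "[int (r + 1) * S M = int r * S n] (mod (int p)\<^sup>2)"
    by (simp add: cong_iff_dvd_diff)
  from rat_cong_of_int[OF p this]
  have "rat_cong p 2 (of_nat (r + 1) * of_int (S M)) (of_nat r * of_int (S n))"
    by simp
  moreover have inv: "1 / of_nat (r + 1) \<in> p_integral p"
    using rp p by (intro p_integral_inverse) auto
  ultimately have "rat_cong p 2 (1 / of_nat (r + 1) * (of_nat (r + 1) * of_int (S M)))
      (1 / of_nat (r + 1) * (of_nat r * of_int (S n)))"
    using rat_cong_mult_left[OF p] by blast
  then have "rat_cong p 2 (of_int (S M)) (1 / of_nat (r + 1) * of_nat r * of_int (S n))"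
    by (simp add: mult.assoc del: of_nat_add of_nat_Suc)
  note rat_cong_trans[OF p harm this]
  also have "rat_cong p 2 (1 / of_nat (r + 1) * of_nat r * of_int (S n))
      (1 / of_nat (r + 1) * of_nat r * (of_nat p * bernoulli n))"
  proof (rule rat_cong_mult_left[OF p])
    show "1 / of_nat (r + 1) * of_nat r \<in> p_integral p"
      using inv p by (intro p_integral_mult p_integral_of_nat)
    show "rat_cong p 2 (of_int (S n)) (of_nat p * bernoulli n)"
      using power_sum_mod_p2[of n] n_M r unfolding gen_harm_neg S_def by simp
  qed
  also (rat_cong_trans[OF p]) have "1 / of_nat (r + 1) * of_nat r * (of_nat p * bernoulli n)
      = of_nat p * (of_nat r / of_nat (r + 1) * bernoulli n)"
    by simp
  finally show ?thesis
    unfolding n_def .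
qed

end

section \<open>The harmonic sum\<close>

lemma harm_sum_eq:
  "harm_sum a b p = (\<Sum>i<p. of_nat i ^ b) * gen_harm (int a) (p - 1)
     - 1 / of_nat (Suc b) * (\<Sum>j\<le>b. of_nat (Suc b choose j) * bernoulli j *
         gen_harm (int a - int (Suc b - j)) (p - 1))"
proof -
  let ?P = "\<lambda>n. \<Sum>i<n. (of_nat i :: rat) ^ b"
  have "harm_sum a b p = (\<Sum>i\<in>{1..p-1}. \<Sum>k | k \<in> {1..p-1} \<and> k \<le> i.
      of_nat i ^ b * of_nat k powi (- int a))"
    unfolding harm_sum_def gen_harm_def sum_distrib_left
    by (intro sum.cong refl) auto
  also have "\<dots> = (\<Sum>k\<in>{1..p-1}. \<Sum>i | i \<in> {1..p-1} \<and> k \<le> i.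
      of_nat i ^ b * of_nat k powi (- int a))"
    by (rule sum.swap_restrict) auto
  also have "\<dots> = (\<Sum>k\<in>{1..p-1}. of_nat k powi (- int a) * (?P p - ?P k))"
  proof (intro sum.cong refl)
    fix k assume k: "k \<in> {1..p-1}"
    then have eq: "{i. i \<in> {1..p-1} \<and> k \<le> i} = {..<p} - {..<k}" by auto
    have "(\<Sum>i | i \<in> {1..p-1} \<and> k \<le> i. (of_nat i :: rat) ^ b) = ?P p - ?P k"
      unfolding eq using k by (intro sum_diff) auto
    then show "(\<Sum>i | i \<in> {1..p-1} \<and> k \<le> i. of_nat i ^ b * of_nat k powi (- int a))
        = of_nat k powi (- int a) * (?P p - ?P k)"
      by (simp only: sum_distrib_right[symmetric] mult.commute)
  qed
  also have "\<dots> = ?P p * gen_harm (int a) (p - 1)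
      - (\<Sum>k=1..p-1. of_nat k powi (- int a) * ?P k)"
    by (simp add: gen_harm_def right_diff_distrib sum_subtractf sum_distrib_left mult.commute)
  also have "(\<Sum>k=1..p-1. of_nat k powi (- int a) * ?P k) =
      (\<Sum>k=1..p-1. \<Sum>j\<le>b. 1 / of_nat (Suc b) * (of_nat (Suc b choose j) * bernoulli j *
         of_nat k powi (- (int a - int (Suc b - j)))))"
  proof (intro sum.cong refl)
    fix k assume "k \<in> {1..p-1}"
    then have "of_nat k powi (- (int a - int m)) = of_nat k powi (- int a) * (of_nat k :: rat) ^ m" for m
      using power_int_add[of "of_nat k :: rat" "- int a" "int m"] by simp
    then show "of_nat k powi (- int a) * ?P k =
      (\<Sum>j\<le>b. 1 / of_nat (Suc b) * (of_nat (Suc b choose j) * bernoulli j *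
         of_nat k powi (- (int a - int (Suc b - j)))))"
      unfolding faulhaber sum_distrib_left by (intro sum.cong refl) (simp only: mult_ac)
  qed
  also have "\<dots> = 1 / of_nat (Suc b) * (\<Sum>j\<le>b. of_nat (Suc b choose j) * bernoulli j *
         gen_harm (int a - int (Suc b - j)) (p - 1))"
    by (subst sum.swap) (simp only: gen_harm_def sum_distrib_left)
  finally show ?thesis .
qed

text \<open>Here \<open>G\<close> stands for whatever is known about the power sums. The boundary term
$P(p) H_{p-1}^{(a)}$ disappears modulo $p^2$ because $P(p)$ and $H_{p-1}^{(a)}$ are both multiples of $p$; for the
latter the bound on $a$ is needed, since $H_{p-1}^{(p-1)} \equiv -1$ modulo $p$.\<close>

lemma harm_sum_cong:
  assumes p: "prime p" and a: "0 < a" "a + 2 \<le> p" and b: "b + 2 \<le> p"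
    and G: "\<And>j. j \<le> b \<Longrightarrow> rat_cong p 2 (gen_harm (int a - int (Suc b - j)) (p - 1)) (G j)"
  shows "rat_cong p 2 (harm_sum a b p)
    (- (1 / of_nat (Suc b) * (\<Sum>j\<le>b. of_nat (Suc b choose j) * bernoulli j * G j)))"
proof -
  let ?H = "gen_harm (int a) (p - 1)" and ?P = "\<Sum>i<p. (of_nat i :: rat) ^ b"
  let ?c = "of_nat a / of_nat (a + 1) * bernoulli (p - 1 - a)"
  have harm: "rat_cong p 2 ?H (of_nat p * ?c)"
    using harmonic_mod_p2[OF p a] .
  have Bb: "bernoulli b \<in> p_integral p"
    using b by (rule bernoulli_p_integral[OF p])
  have "1 / of_nat (a + 1) \<in> p_integral p"
    using a p by (intro p_integral_inverse) auto
  moreover have "bernoulli (p - 1 - a) \<in> p_integral p"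
    using a by (intro bernoulli_p_integral[OF p]) auto
  ultimately have "1 / of_nat (a + 1) * of_nat a * bernoulli (p - 1 - a) \<in> p_integral p"
    using p by (intro p_integral_mult p_integral_of_nat)
  then have c: "?c \<in> p_integral p" by simp
  have "rat_cong p 2 (?H * ?P) (?H * (of_nat p * bernoulli b))"
    using rat_cong_integral_left[OF p harm] faulhaber_mod_p2[OF p b]
    by (rule rat_cong_mult_left[OF p])
  then have 1: "rat_cong p 2 (?P * ?H) (of_nat p * bernoulli b * ?H)"
    by (simp only: mult.commute)
  have 2: "rat_cong p 2 (of_nat p * bernoulli b * ?H) (of_nat p * bernoulli b * (of_nat p * ?c))"
    using p_integral_mult[OF p p_integral_of_nat[OF p] Bb] harm by (rule rat_cong_mult_left[OF p])
  have "rat_cong p 2 ((of_nat p)\<^sup>2 * (bernoulli b * ?c)) 0"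
    using p_integral_mult[OF p Bb c] by (rule rat_cong_power_mult_0[OF p])
  then have 3: "rat_cong p 2 (of_nat p * bernoulli b * (of_nat p * ?c)) 0"
    by (simp only: power2_eq_square mult_ac)
  from rat_cong_trans[OF p rat_cong_trans[OF p 1 2] 3]
  have first: "rat_cong p 2 (?P * ?H) 0" .
  have inv: "- (1 / of_nat (Suc b)) \<in> p_integral p"
    using p b by (intro p_integral_uminus p_integral_inverse) auto
  have "rat_cong p 2 (\<Sum>j\<le>b. of_nat (Suc b choose j) * bernoulli j *
         gen_harm (int a - int (Suc b - j)) (p - 1))
      (\<Sum>j\<le>b. of_nat (Suc b choose j) * bernoulli j * G j)"
  proof (rule rat_cong_sum[OF p], rule rat_cong_mult_left[OF p])
    fix j assume "j \<in> {..b}"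
    then show "rat_cong p 2 (gen_harm (int a - int (Suc b - j)) (p - 1)) (G j)"
      using G by simp
    show "of_nat (Suc b choose j) * bernoulli j \<in> p_integral p"
      using p b \<open>j \<in> {..b}\<close>
      by (intro p_integral_mult p_integral_of_nat bernoulli_p_integral) auto
  qed
  from rat_cong_add[OF p first rat_cong_mult_left[OF p inv this]]
  show ?thesis unfolding harm_sum_eq by simp
qed

theorem theorem1:
  fixes a b p :: nat
  assumes "prime p" and "max a b + 3 \<le> p"
  shows "(0 < a \<and> a \<le> b \<longrightarrow>
      rat_cong p 2 (harm_sum a b p)
        (1 / of_nat (b + 1) * of_nat ((b + 1) choose a) * bernoulli (b - a + 1)
         - of_nat p / of_nat (b + 1)
             * (\<Sum>j=0..b - a + 1. of_nat ((b + 1) choose j) * bernoulli (b - a + 1 - j) * bernoulli j)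
         - of_nat p / of_nat (b + 1)
             * (\<Sum>j=b - a + 2..b. of_nat ((b + 1) choose j) * bern_sharp (int a) (int b) (int j) p)))
    \<and> (0 < a \<and> a = b + 1 \<longrightarrow>
      rat_cong p 2 (harm_sum a b p)
        ((1 - of_nat p) / of_nat a
         - of_nat p / of_nat a
             * (\<Sum>j=1..a - 1. of_nat (a choose j) * bern_sharp (int a) (int a - 1) (int j) p)))
    \<and> (0 < b + 1 \<and> b + 1 < a \<longrightarrow>
      rat_cong p 2 (harm_sum a b p)
        (- (of_nat p / of_nat (b + 1)
             * (\<Sum>j=0..b. of_nat ((b + 1) choose j) * bern_sharp (int a) (int b) (int j) p))))"
proof -
  have p: "prime p" and a: "a + 3 \<le> p" and b: "b + 3 \<le> p"
    using assms by auto
  let ?H = "\<lambda>j. gen_harm (int a - int (Suc b - j)) (p - 1)"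
  let ?C = "\<lambda>j. of_nat (Suc b choose j) :: rat"
  \<comment> \<open>The exponent \<open>b + 1 - a - j\<close> of the power sum may be positive, zero or negative, and each sign
    has its own congruence.\<close>
  have pos: "rat_cong p 2 (?H j) (of_nat p * bernoulli (b + 1 - a - j))" if "j + a \<le> b" for j
  proof -
    have eq: "int a - int (Suc b - j) = - int (b + 1 - a - j)"
      using that by (simp add: of_nat_diff)
    show ?thesis
      unfolding eq using that b by (intro power_sum_mod_p2[OF p]) auto
  qed
  have zero: "rat_cong p 2 (?H j) (of_nat p - 1)" if "j + a = b + 1" for j
  proof -
    have "Suc b - j = a" using that by simp
    moreover have "of_nat (p - 1) = (of_nat p - 1 :: rat)"
      using b by (simp add: of_nat_diff)
    ultimately show ?thesis
      using p by (simp add: gen_harm_zero rat_cong_refl)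
  qed
  have neg: "rat_cong p 2 (?H j)
      (of_nat p * (of_int (int a - int b - 1 + int j) / of_int (int a - int b + int j)
         * bernoulli (nat (int p - int a + int b - int j))))"
    if "b + 1 < j + a" "j \<le> b" for j
  proof -
    define r where "r = j + a - (b + 1)"
    have r: "int a - int (Suc b - j) = int r" "int a - int b - 1 + int j = int r"
        "int a - int b + int j = int (r + 1)" "nat (int p - int a + int b - int j) = p - 1 - r"
      using that a by (auto simp: r_def of_nat_diff)
    show ?thesis
      unfolding r of_int_of_nat_eq
      using that a by (intro harmonic_mod_p2[OF p]) (auto simp: r_def)
  qed
  have reduce: "rat_cong p 2 (harm_sum a b p) x"
    if "0 < a" "\<And>j. j \<le> b \<Longrightarrow> rat_cong p 2 (?H j) (G j)"
      "x = - (1 / of_nat (Suc b) * (\<Sum>j\<le>b. ?C j * bernoulli j * G j))" for G x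
    unfolding that(3) using that(1,2) a b by (intro harm_sum_cong[OF p]) auto
  show ?thesis
  proof (intro conjI impI)
    assume ab: "0 < a \<and> a \<le> b"
    define m where "m = b + 1 - a"
    have m: "b - a + 1 = m" "b - a + 2 = Suc m" "m \<le> b" "m + a = b + 1"
      using ab by (auto simp: m_def)
    define G where "G = (\<lambda>j. if j \<le> m then of_nat p * bernoulli (m - j) - (if j = m then 1 else 0)
      else of_nat p * (of_int (int a - int b - 1 + int j) / of_int (int a - int b + int j)
         * bernoulli (nat (int p - int a + int b - int j))))"
    \<comment> \<open>The correction at \<open>j = m\<close> is the \<open>- 1\<close> in \<open>p - 1 = p * bernoulli 0 - 1\<close>; it becomes the leading
      term of the congruence.\<close>
    have low: "(\<Sum>j\<in>{0..m}. ?C j * bernoulli j * G j) =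
        of_nat p * (\<Sum>j=0..m. ?C j * bernoulli (m - j) * bernoulli j) - ?C m * bernoulli m"
    proof -
      have "(\<Sum>j\<in>{0..m}. ?C j * bernoulli j * G j) =
         (\<Sum>j\<in>{0..m}. of_nat p * (?C j * bernoulli (m - j) * bernoulli j)
             - (if j = m then ?C m * bernoulli m else 0))"
        by (intro sum.cong refl) (auto simp: G_def algebra_simps simp del: binomial_Suc_Suc)
      then show ?thesis
        by (simp add: sum_subtractf sum_distrib_left del: binomial_Suc_Suc)
    qed
    have high: "(\<Sum>j\<in>{Suc m..b}. ?C j * bernoulli j * G j) =
        of_nat p * (\<Sum>j=Suc m..b. ?C j * bern_sharp (int a) (int b) (int j) p)"
      unfolding sum_distrib_left
      by (intro sum.cong refl) (simp add: G_def bern_sharp_def mult_ac del: binomial_Suc_Suc)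
    have "{..b} = {0..m} \<union> {Suc m..b}" using m by auto
    then have split: "(\<Sum>j\<le>b. ?C j * bernoulli j * G j) =
        (\<Sum>j\<in>{0..m}. ?C j * bernoulli j * G j) + (\<Sum>j\<in>{Suc m..b}. ?C j * bernoulli j * G j)"
      by (simp only:) (intro sum.union_disjoint, auto)
    have choose: "Suc b choose m = (b + 1) choose a"
      using binomial_symmetric[of m "b + 1"] m by (metis Suc_eq_plus1 add_diff_cancel_left' le_add1)
    have arith: "1 / c * t * w - q / c * u - q / c * v = - (1 / c * ((q * u - t * w) + q * v))"
      for c t u v w q :: rat
      by (simp add: algebra_simps add_divide_distrib diff_divide_distrib)
    show "rat_cong p 2 (harm_sum a b p)
        (1 / of_nat (b + 1) * of_nat ((b + 1) choose a) * bernoulli (b - a + 1)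
         - of_nat p / of_nat (b + 1)
             * (\<Sum>j=0..b - a + 1. of_nat ((b + 1) choose j) * bernoulli (b - a + 1 - j) * bernoulli j)
         - of_nat p / of_nat (b + 1)
             * (\<Sum>j=b - a + 2..b. of_nat ((b + 1) choose j) * bern_sharp (int a) (int b) (int j) p))"
      unfolding m
    proof (intro reduce[of G])
      fix j assume "j \<le> b"
      then consider "j + a \<le> b" | "j + a = b + 1" | "b + 1 < j + a" by linarith
      then show "rat_cong p 2 (?H j) (G j)"
        using pos[of j] zero[of j] neg[of j] \<open>j \<le> b\<close> m
        by cases (auto simp: G_def m_def)
    qed (use ab in simp, unfold split low high choose arith, simp only: Suc_eq_plus1)
  next
    assume ab: "0 < a \<and> a = b + 1"
    define G where "G = (\<lambda>j. if j = 0 then of_nat p - 1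
      else of_nat p * (of_int (int a - int b - 1 + int j) / of_int (int a - int b + int j)
         * bernoulli (nat (int p - int a + int b - int j))))"
    have "{..b} = insert 0 {1..a - 1}" using ab by auto
    then have split: "(\<Sum>j\<le>b. ?C j * bernoulli j * G j) =
        of_nat p - 1 + (\<Sum>j=1..a - 1. ?C j * bernoulli j * G j)"
      by (simp add: G_def del: binomial_Suc_Suc)
    have high: "(\<Sum>j=1..a - 1. ?C j * bernoulli j * G j) =
        of_nat p * (\<Sum>j=1..a - 1. of_nat (a choose j) * bern_sharp (int a) (int a - 1) (int j) p)"
      unfolding sum_distrib_left
      using ab by (intro sum.cong refl) (simp add: G_def bern_sharp_def mult_ac del: binomial_Suc_Suc)
    show "rat_cong p 2 (harm_sum a b p)
        ((1 - of_nat p) / of_nat a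
         - of_nat p / of_nat a
             * (\<Sum>j=1..a - 1. of_nat (a choose j) * bern_sharp (int a) (int a - 1) (int j) p))"
    proof (intro reduce[of G])
      fix j assume "j \<le> b"
      then show "rat_cong p 2 (?H j) (G j)"
        using zero[of j] neg[of j] ab by (cases "j = 0") (auto simp: G_def)
    next
      have arith: "(1 - q) / c - q / c * u = - (1 / c * (q - 1 + q * u))" for c u q :: rat
        by (simp add: algebra_simps add_divide_distrib diff_divide_distrib)
      have a_eq: "Suc b = a" using ab by simp
      show "(1 - of_nat p) / of_nat a
         - of_nat p / of_nat a
             * (\<Sum>j=1..a - 1. of_nat (a choose j) * bern_sharp (int a) (int a - 1) (int j) p)
         = - (1 / of_nat (Suc b) * (\<Sum>j\<le>b. ?C j * bernoulli j * G j))"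
        unfolding split high arith unfolding a_eq ..
    qed (use ab in simp)
  next
    assume ab: "0 < b + 1 \<and> b + 1 < a"
    have "(\<Sum>j\<le>b. ?C j * bernoulli j *
        (of_nat p * (of_int (int a - int b - 1 + int j) / of_int (int a - int b + int j)
         * bernoulli (nat (int p - int a + int b - int j))))) =
        of_nat p * (\<Sum>j=0..b. of_nat ((b + 1) choose j) * bern_sharp (int a) (int b) (int j) p)"
      unfolding sum_distrib_left atMost_atLeast0
      by (intro sum.cong refl) (simp add: bern_sharp_def mult_ac del: binomial_Suc_Suc)
    then show "rat_cong p 2 (harm_sum a b p)
        (- (of_nat p / of_nat (b + 1)
             * (\<Sum>j=0..b. of_nat ((b + 1) choose j) * bern_sharp (int a) (int b) (int j) p)))"
      using ab by (intro reduce[OF _ neg]) (auto simp del: binomial_Suc_Suc)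
  qed
qed

end
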